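(* Let $\mathcal{T}_1$ and $\mathcal{T}_2$ be two reversible two-way finite state transducers with $n_1$ and $n_2$ states respectively, such that $\mathcal{T}_1$ can be composed with $\mathcal{T}_2$ (i.e. the output alphabet of $\mathcal{T}_1$ is the input alphabet of $\mathcal{T}_2$). Then one can construct a reversible two-way finite state transducer $\mathcal{T}_3$ with $n_1\cdot n_2$ states realizing $\mathcal{R}_{\mathcal{T}_2}\circ\mathcal{R}_{\mathcal{T}_1}$, that is, $\mathcal{R}_{\mathcal{T}_3}=\mathcal{R}_{\mathcal{T}_2}\circ\mathcal{R}_{\mathcal{T}_1}$.
   Context: For a finite alphabet $A$, let $A_{\vdash\dashv}=A\uplus\{\vdash,\dashv\}$, where $\vdash,\dashv$ are new symbols called endmarkers. A two-way finite state automaton (2FA) is a tuple $\mathcal{A}=(A,Q,q_I,q_F,\Delta)$, where $A$ is a finite alphabet, $Q$ is a finite set of states partitioned into forward states $Q^+$ and backward states $Q^-$, $q_I\in Q^+$ is the initial state, $q_F\in Q^+$ is the final state, and $\Delta\subseteq Q\times A_{\vdash\dashv}\times Q$. By convention, $q_I$ is the only forward state $p$ with a transition $(p,\vdash,q)\in\Delta$ and $q_F$ is the only forward state $p$ with a transition $(q,\dashv,p)\in\Delta$ (backward states may have transitions $(p,\vdash,q)$ and $(q,\dashv,p)$). A configuration $u.p.u'$ consists of words $u,u'\in A_{\vdash\dashv}^*$ and a state $p$. If $p\in Q^+$ and $u'=a'v'$ with $a'$ a letter, then for each $(p,a',q)\in\Delta$ a successor of $u.p.u'$ is $ua'.q.v'$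 if $q\in Q^+$, and $u.q.u'$ if $q\in Q^-$. If $p\in Q^-$ and $u=va$ with $a$ a letter, then for each $(p,a,q)\in\Delta$ a successor of $u.p.u'$ is $u.q.u'$ if $q\in Q^+$, and $v.q.au'$ if $q\in Q^-$. A run on $w$ is a finite sequence of successive configurations $u_i.q_i.u_i'$ with $u_iu_i'=w$; it is accepting if it starts in $q_I.w$ and ends in $w.q_F$. The automaton is deterministic if for all $(p,a)\in Q\times A_{\vdash\dashv}$ there is at most one $q$ with $(p,a,q)\in\Delta$; co-deterministic if for all $(q,a)\in Q\times A_{\vdash\dashv}$ there is at most one $p$ with $(p,a,q)\in\Delta$; reversible if it is both deterministic and co-deterministic. A two-way finite state transducer (2FT) is a tuple $\mathcal{T}=(A,B,Q,q_I,q_F,\Delta,\mu)$ where $B$ is a finite (output) alphabet, $(A,Q,q_I,q_F,\Delta)$ is a 2FA (the underlying automaton) and $\mu:\Delta\to B^*$. For a run $\rho$, $\mu(\rho)$ is the concatenation of the outputs of the transitions along $\rho$. The transduction $\mathcal{R}_{\mathcal{T}}\subseteq A^*\times B^*$ is the set of pairs $(u,\mu(\rho))$ with $\rho$ an accepting run on $\vdash u\dashv$. A transducer is deterministic, co-deterministic or reversible if its underlying automaton is. The number of states is $|Q|$. For relations, $\mathcal{R}_2\circ\mathcal{R}_1=\{(u,w)\mid\exists v:(u,v)\in\mathcal{R}_1,(v,w)\in\mathcal{R}_2\}$. *)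

theory Defs
  imports Main
begin

text \<open>Two-way finite state automata and transducers. Alphabets and state sets are explicit finite
  carrier sets. A transducer record extends the record of its underlying automaton, so everything
  defined on the record scheme below applies to both.\<close>

datatype 'a marked = Letter 'a | LeftEnd | RightEnd

definition marked_alphabet :: "'a set \<Rightarrow> 'a marked set" where
  "marked_alphabet A = Letter ` A \<union> {LeftEnd, RightEnd}"

definition mark_word :: "'a list \<Rightarrow> 'a marked list" where
  "mark_word u = LeftEnd # map Letter u @ [RightEnd]"

type_synonym ('a, 'q) transition = "'q \<times> 'a marked \<times> 'q"

type_synonym ('a, 'q) config = "'a marked list \<times> 'q \<times> 'a marked list"

record ('a, 'q) two_fa =
  alphabet :: "'a set"
  fwd_states :: "'q set"
  bwd_states :: "'q set"
  initial :: 'q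
  final :: 'q
  transitions :: "('a, 'q) transition set"

text \<open>Only the values of \<open>out_word\<close> on the transitions of the transducer are relevant.\<close>

record ('a, 'q, 'b) two_ft = "('a, 'q) two_fa" +
  out_alphabet :: "'b set"
  out_word :: "('a, 'q) transition \<Rightarrow> 'b list"

definition states :: "('a, 'q, 'z) two_fa_scheme \<Rightarrow> 'q set" where
  "states M = fwd_states M \<union> bwd_states M"

text \<open>The last two conjuncts constrain forward states only; backward states may have arbitrary
  transitions on endmarkers. They do not demand that the initial (final) state actually has a
  transition on the left (right) endmarker.\<close>

definition is_two_fa :: "('a, 'q, 'z) two_fa_scheme \<Rightarrow> bool" where
  "is_two_fa M \<longleftrightarrow>
     finite (alphabet M) \<and>
     finite (fwd_states M) \<and> finite (bwd_states M) \<and> fwd_states M \<inter> bwd_states M = {} \<and>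
     initial M \<in> fwd_states M \<and> final M \<in> fwd_states M \<and>
     transitions M \<subseteq> states M \<times> marked_alphabet (alphabet M) \<times> states M \<and>
     (\<forall>p q. p \<in> fwd_states M \<and> (p, LeftEnd, q) \<in> transitions M \<longrightarrow> p = initial M) \<and>
     (\<forall>p q. p \<in> fwd_states M \<and> (q, RightEnd, p) \<in> transitions M \<longrightarrow> p = final M)"

definition is_two_ft :: "('a, 'q, 'b) two_ft \<Rightarrow> bool" where
  "is_two_ft T \<longleftrightarrow>
     is_two_fa T \<and> finite (out_alphabet T) \<and>
     (\<forall>t \<in> transitions T. out_word T t \<in> lists (out_alphabet T))"

definition deterministic :: "('a, 'q, 'z) two_fa_scheme \<Rightarrow> bool" where
  "deterministic M \<longleftrightarrow>
     (\<forall>p \<in> states M. \<forall>a \<in> marked_alphabet (alphabet M).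
        \<exists>\<^sub>\<le>\<^sub>1 q. (p, a, q) \<in> transitions M)"

definition codeterministic :: "('a, 'q, 'z) two_fa_scheme \<Rightarrow> bool" where
  "codeterministic M \<longleftrightarrow>
     (\<forall>q \<in> states M. \<forall>a \<in> marked_alphabet (alphabet M).
        \<exists>\<^sub>\<le>\<^sub>1 p. (p, a, q) \<in> transitions M)"

definition reversible :: "('a, 'q, 'z) two_fa_scheme \<Rightarrow> bool" where
  "reversible M \<longleftrightarrow> deterministic M \<and> codeterministic M"

definition configs :: "('a, 'q, 'z) two_fa_scheme \<Rightarrow> ('a, 'q) config set" where
  "configs M = lists (marked_alphabet (alphabet M)) \<times> states M \<times> lists (marked_alphabet (alphabet M))"

inductive successor :: "('a, 'q, 'z) two_fa_scheme \<Rightarrow> ('a, 'q) config \<Rightarrow> ('a, 'q) config \<Rightarrow> bool"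
  for M where
  fwd_fwd: "\<lbrakk>(p, a, q) \<in> transitions M; p \<in> fwd_states M; q \<in> fwd_states M\<rbrakk>
    \<Longrightarrow> successor M (u, p, a # v) (u @ [a], q, v)"
| fwd_bwd: "\<lbrakk>(p, a, q) \<in> transitions M; p \<in> fwd_states M; q \<in> bwd_states M\<rbrakk>
    \<Longrightarrow> successor M (u, p, a # v) (u, q, a # v)"
| bwd_fwd: "\<lbrakk>(p, a, q) \<in> transitions M; p \<in> bwd_states M; q \<in> fwd_states M\<rbrakk>
    \<Longrightarrow> successor M (u @ [a], p, v) (u @ [a], q, v)"
| bwd_bwd: "\<lbrakk>(p, a, q) \<in> transitions M; p \<in> bwd_states M; q \<in> bwd_states M\<rbrakk>
    \<Longrightarrow> successor M (u @ [a], p, v) (u, q, a # v)"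

definition is_run :: "('a, 'q, 'z) two_fa_scheme \<Rightarrow> 'a marked list \<Rightarrow> ('a, 'q) config list \<Rightarrow> bool" where
  "is_run M w \<rho> \<longleftrightarrow>
     \<rho> \<noteq> [] \<and> \<rho> \<in> lists (configs M) \<and> successively (successor M) \<rho> \<and>
     (\<forall>(u, q, u') \<in> set \<rho>. u @ u' = w)"

definition accepting_run ::
  "('a, 'q, 'z) two_fa_scheme \<Rightarrow> 'a marked list \<Rightarrow> ('a, 'q) config list \<Rightarrow> bool" where
  "accepting_run M w \<rho> \<longleftrightarrow>
     is_run M w \<rho> \<and> hd \<rho> = ([], initial M, w) \<and> last \<rho> = (w, final M, [])"

text \<open>A configuration and its successor determine the transition between them: forward states read
  the letter to their right, backward states the letter to their left.\<close>

fun transition_between ::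
  "('a, 'q, 'z) two_fa_scheme \<Rightarrow> ('a, 'q) config \<Rightarrow> ('a, 'q) config \<Rightarrow> ('a, 'q) transition" where
  "transition_between M (u, p, u') (v, q, v') =
     (p, if p \<in> fwd_states M then hd u' else last u, q)"

definition run_output :: "('a, 'q, 'b) two_ft \<Rightarrow> ('a, 'q) config list \<Rightarrow> 'b list" where
  "run_output T \<rho> =
     concat (map2 (\<lambda>c c'. out_word T (transition_between T c c')) (butlast \<rho>) (tl \<rho>))"

definition transduction :: "('a, 'q, 'b) two_ft \<Rightarrow> ('a list \<times> 'b list) set" where
  "transduction T =
     {(u, run_output T \<rho>) | u \<rho>. u \<in> lists (alphabet T) \<and> accepting_run T (mark_word u) \<rho>}"

end

theory Submission
  imports Defs
begin

text \<open>The composed transducer simulates \<open>T2\<close> on the output of \<open>T1\<close>, one \<open>T1\<close>-transition \<open>t\<close> at a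
  time: a state \<open>(p, q)\<close> says that \<open>T1\<close> is in state \<open>p\<close> and that \<open>T2\<close>, in state \<open>q\<close>, sits at the
  boundary between the output of the last and the output of the next transition of \<open>T1\<close>. If \<open>T2\<close>
  enters the output of \<open>t\<close> from the left and exits on the right, then \<open>T1\<close> moves on; if \<open>T2\<close> enters
  from the right and exits on the left, then \<open>T1\<close> undoes \<open>t\<close>, which is possible since \<open>T1\<close> is
  co-deterministic; if \<open>T2\<close> turns around, then \<open>T1\<close> stays where it is. The endmarkers
  of the input of \<open>T2\<close> are prepended and appended to the outputs of the unique first and last
  transitions of \<open>T1\<close>.\<close>

section \<open>Labelled steps\<close>

text \<open>The configurations immediately before and after reading the letter \<open>a\<close> between \<open>x\<close> and \<open>y\<close>. In
  these terms the four clauses of \<open>successor\<close> become a single one.\<close>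

definition before :: "('a, 'q, 'z) two_fa_scheme \<Rightarrow> 'a marked list \<Rightarrow> 'a marked \<Rightarrow> 'a marked list \<Rightarrow> 'q
    \<Rightarrow> ('a, 'q) config" where
  "before M x a y p = (if p \<in> fwd_states M then (x, p, a # y) else (x @ [a], p, y))"

definition after :: "('a, 'q, 'z) two_fa_scheme \<Rightarrow> 'a marked list \<Rightarrow> 'a marked \<Rightarrow> 'a marked list \<Rightarrow> 'q
    \<Rightarrow> ('a, 'q) config" where
  "after M x a y q = (if q \<in> fwd_states M then (x @ [a], q, y) else (x, q, a # y))"

definition step :: "('a, 'q, 'z) two_fa_scheme \<Rightarrow> ('a, 'q) config \<Rightarrow> ('a, 'q) transition
    \<Rightarrow> ('a, 'q) config \<Rightarrow> bool" where
  "step M c t c' \<longleftrightarrow> (\<exists>x y p a q. t = (p, a, q) \<and> (p, a, q) \<in> transitions M \<and>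
     c = before M x a y p \<and> c' = after M x a y q)"

fun steps :: "('a, 'q, 'z) two_fa_scheme \<Rightarrow> ('a, 'q) config \<Rightarrow> ('a, 'q) transition list
    \<Rightarrow> ('a, 'q) config \<Rightarrow> bool" where
  "steps M c [] c' \<longleftrightarrow> c = c'"
| "steps M c (t # ts) c' \<longleftrightarrow> (\<exists>d. step M c t d \<and> steps M d ts c')"

text \<open>Border configurations of a word \<open>w\<close>: a forward state enters on the left and
  leaves on the right, any other state the reverse. They serve for whole runs and for passages
  through a factor of a longer tape.\<close>

definition entry :: "('a, 'q, 'z) two_fa_scheme \<Rightarrow> 'a marked list \<Rightarrow> 'q \<Rightarrow> ('a, 'q) config" where
  "entry M w q = (if q \<in> fwd_states M then ([], q, w) else (w, q, []))"

definition exit :: "('a, 'q, 'z) two_fa_scheme \<Rightarrow> 'a marked list \<Rightarrow> 'q \<Rightarrow> ('a, 'q) config" where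
  "exit M w q = (if q \<in> fwd_states M then (w, q, []) else ([], q, w))"

fun lift :: "'a marked list \<Rightarrow> 'a marked list \<Rightarrow> ('a, 'q) config \<Rightarrow> ('a, 'q) config" where
  "lift x y (u, p, v) = (x @ u, p, v @ y)"

fun tape :: "('a, 'q) config \<Rightarrow> 'a marked list" where
  "tape (u, p, v) = u @ v"

fun state :: "('a, 'q) config \<Rightarrow> 'q" where
  "state (u, p, v) = p"

lemma stepI:
  "(p, a, q) \<in> transitions M \<Longrightarrow> step M (before M x a y p) (p, a, q) (after M x a y q)"
  unfolding step_def by blast

lemma stepE:
  assumes "step M c t c'"
  obtains x a y p q where "t = (p, a, q)" "(p, a, q) \<in> transitions M"
    "c = before M x a y p" "c' = after M x a y q"
  using assms unfolding step_def by blast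

lemma before_inject: "before M x a y p = before M x' a' y' p' \<longleftrightarrow> x = x' \<and> a = a' \<and> y = y' \<and> p = p'"
  unfolding before_def by auto

lemma after_inject: "after M x a y p = after M x' a' y' p' \<longleftrightarrow> x = x' \<and> a = a' \<and> y = y' \<and> p = p'"
  unfolding after_def by auto

text \<open>In \<open>exit\<close> the head faces the border of the word, whereas
  \<open>before\<close> has a letter on the side that is read. This is why exits have no successor
  and, dually, entries have no predecessor.\<close>

lemma before_neq_exit: "before M x a y p \<noteq> exit M w q"
  unfolding before_def exit_def by auto

lemma after_neq_entry: "after M x a y p \<noteq> entry M w q"
  unfolding after_def entry_def by auto

lemma step_from_exit: "\<not> step M (exit M w q) t c"
  unfolding step_def using before_neq_exit by metis

lemma step_to_entry: "\<not> step M c t (entry M w q)"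
  unfolding step_def using after_neq_entry by metis

lemma steps_from_exit: "steps M (exit M w q) ts c \<longleftrightarrow> ts = [] \<and> c = exit M w q"
  by (cases ts) (auto simp: step_from_exit)

lemma state_simps [simp]:
  "state (before M x a y p) = p" "state (after M x a y p) = p"
  "state (entry M w p) = p" "state (exit M w p) = p"
  by (simp_all add: before_def after_def entry_def exit_def)

lemma tape_simps [simp]:
  "tape (before M x a y p) = x @ a # y" "tape (after M x a y p) = x @ a # y"
  "tape (entry M w p) = w" "tape (exit M w p) = w"
  by (simp_all add: before_def after_def entry_def exit_def)

lemma entry_eq_iff: "entry M w p = entry M w' q \<longleftrightarrow> w = w' \<and> p = q"
  unfolding entry_def by auto

lemma exit_eq_iff: "exit M w p = exit M w' q \<longleftrightarrow> w = w' \<and> p = q"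
  unfolding exit_def by auto

lemma steps_ConsI: "step M c t d \<Longrightarrow> steps M d ts c' \<Longrightarrow> steps M c (t # ts) c'"
  unfolding steps.simps by blast

lemma steps_append: "steps M c (ts @ us) c' \<longleftrightarrow> (\<exists>d. steps M c ts d \<and> steps M d us c')"
  by (induction ts arbitrary: c) (simp, unfold append_Cons steps.simps, blast)

lemma steps_snocI: "steps M c ts d \<Longrightarrow> step M d t c' \<Longrightarrow> steps M c (ts @ [t]) c'"
  unfolding steps_append steps.simps by blast

lemma step_tape: "step M c t c' \<Longrightarrow> tape c' = tape c"
  by (elim stepE) simp

lemma step_states:
  assumes "is_two_fa M" "step M c t c'"
  shows "t \<in> transitions M" "state c \<in> states M" "state c' \<in> states M"
  using assms unfolding is_two_fa_def by (auto elim!: stepE)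

lemma steps_transitions: "steps M c ts c' \<Longrightarrow> set ts \<subseteq> transitions M"
  by (induction ts arbitrary: c) (auto elim: stepE)

lemma steps_states:
  assumes "is_two_fa M"
  shows "steps M c ts c' \<Longrightarrow> state c \<in> states M \<Longrightarrow> state c' \<in> states M"
  by (induction ts arbitrary: c) (auto dest: step_states[OF assms])

lemma step_lift: "step M c t c' \<Longrightarrow> step M (lift x y c) t (lift x y c')"
  unfolding step_def before_def after_def by fastforce

lemma steps_lift: "steps M c ts c' \<Longrightarrow> steps M (lift x y c) ts (lift x y c')"
  by (induction ts arbitrary: c) (simp, unfold steps.simps, blast dest: step_lift)

text \<open>As long as the head does not face the border of the inner tape, the letter read lies
  inside it, so the step cannot see \<open>x\<close> and \<open>y\<close>.\<close>

lemma step_unlift: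
  assumes "step M (lift x y c) t c'" and "c \<noteq> exit M (tape c) (state c)"
  obtains d where "step M c t d" "c' = lift x y d"
proof -
  obtain u q v where c: "c = (u, q, v)" by (cases c)
  from assms(1) obtain x' a y' p q' where t: "t = (p, a, q')" "(p, a, q') \<in> transitions M"
    and b: "lift x y c = before M x' a y' p" and c': "c' = after M x' a y' q'"
    by (rule stepE)
  have qp: "p = q" using b c by (auto simp: before_def split: if_splits)
  show thesis
  proof (cases "q \<in> fwd_states M")
    case True
    then obtain b' v' where v: "v = b' # v'" using assms(2) c by (cases v) (auto simp: exit_def)
    have "b' = a" "x' = x @ u" "y' = v' @ y" using b c v qp True by (auto simp: before_def)
    then show thesis using t c' c v qp True
      by (intro that[of "after M u a v' q'"]) (auto simp: step_def before_def after_def)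
  next
    case False
    then obtain b' u' where u: "u = u' @ [b']" using assms(2) c
      by (cases u rule: rev_cases) (auto simp: exit_def)
    have "x @ u' @ [b'] = x' @ [a]" "v @ y = y'" using b c u qp False by (auto simp: before_def)
    then have "x @ u' = x'" "b' = a" "y' = v @ y" by (auto simp flip: append_assoc)
    then show thesis using t c' c u qp False
      by (intro that[of "after M u' a v q'"]) (auto simp: step_def before_def after_def)
  qed
qed

text \<open>A run that leaves the whole tape has to leave the factor first. It is cut where the head
  first faces the border of the factor; this may be on either side, whatever the direction of
  \<open>f\<close>.\<close>

lemma steps_split_at_exit:
  assumes "steps M (lift x y c) ts (exit M (x @ tape c @ y) f)"
  obtains ts1 ts2 q where "ts = ts1 @ ts2" "steps M c ts1 (exit M (tape c) q)"
    "steps M (lift x y (exit M (tape c) q)) ts2 (exit M (x @ tape c @ y) f)"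
proof -
  have "\<exists>ts1 ts2 q. ts = ts1 @ ts2 \<and> steps M c ts1 (exit M (tape c) q) \<and>
    steps M (lift x y (exit M (tape c) q)) ts2 (exit M (x @ tape c @ y) f)"
    using assms
  proof (induction ts arbitrary: c)
    case Nil
    \<comment> \<open>A head facing the border of the long tape also faces the border of the factor,
      and the surrounding word on that side is empty.\<close>
    then have "c = exit M (tape c) f" by (cases c) (auto simp: exit_def split: if_splits)
    then have "steps M c [] (exit M (tape c) f)" by simp
    moreover have "steps M (lift x y (exit M (tape c) f)) [] (exit M (x @ tape c @ y) f)"
      using Nil \<open>c = exit M (tape c) f\<close> by simp
    ultimately show ?case by blast
  next
    case (Cons t ts)
    show ?case
    proof (cases "c = exit M (tape c) (state c)")
      case True
      then have "steps M c [] (exit M (tape c) (state c))" by simp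
      then show ?thesis using Cons.prems True by (metis append_Nil)
    next
      case False
      obtain d' where d': "step M (lift x y c) t d'" "steps M d' ts (exit M (x @ tape c @ y) f)"
        using Cons.prems by auto
      obtain d where d: "step M c t d" "d' = lift x y d"
        by (rule step_unlift[OF d'(1) False]) auto
      have tp: "tape d = tape c" using d(1) by (rule step_tape)
      have "steps M (lift x y d) ts (exit M (x @ tape d @ y) f)" using d'(2) d(2) tp by simp
      from Cons.IH[OF this] obtain ts1 ts2 q where "ts = ts1 @ ts2"
        "steps M d ts1 (exit M (tape c) q)"
        "steps M (lift x y (exit M (tape c) q)) ts2 (exit M (x @ tape c @ y) f)"
        unfolding tp by blast
      moreover from this d(1) have "steps M c (t # ts1) (exit M (tape c) q)"
        by (intro steps_ConsI)
      ultimately show ?thesis by (metis append_Cons)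
    qed
  qed
  then show thesis using that by blast
qed

section \<open>Uniqueness of runs under determinism and co-determinism\<close>

lemma deterministicD:
  assumes "is_two_fa M" "deterministic M" "(p, a, q) \<in> transitions M" "(p, a, q') \<in> transitions M"
  shows "q = q'"
proof -
  have "p \<in> states M" "a \<in> marked_alphabet (alphabet M)"
    using assms unfolding is_two_fa_def by auto
  then show ?thesis using assms unfolding deterministic_def Uniq_def by blast
qed

lemma codeterministicD:
  assumes "is_two_fa M" "codeterministic M" "(p, a, q) \<in> transitions M" "(p', a, q) \<in> transitions M"
  shows "p = p'"
proof -
  have "q \<in> states M" "a \<in> marked_alphabet (alphabet M)"
    using assms unfolding is_two_fa_def by auto
  then show ?thesis using assms unfolding codeterministic_def Uniq_def by blast
qed

lemma step_deterministic:
  assumes "is_two_fa M" "deterministic M" "step M c t d" "step M c t' d'"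
  shows "t = t' \<and> d = d'"
  using assms(3,4) by (auto elim!: stepE simp: before_inject dest: deterministicD[OF assms(1,2)])

lemma step_codeterministic:
  assumes "is_two_fa M" "codeterministic M" "step M c t d" "step M c' t' d"
  shows "t = t' \<and> c = c'"
  using assms(3,4) by (auto elim!: stepE simp: after_inject dest: codeterministicD[OF assms(1,2)])

text \<open>Determinism makes the two runs agree step by step, and since an exit has no successor,
  neither can outlast the other.\<close>

lemma steps_to_exit_unique:
  assumes "is_two_fa M" "deterministic M"
  shows "steps M c ts (exit M w q) \<Longrightarrow> steps M c ts' (exit M w' q') \<Longrightarrow> ts = ts' \<and> w = w' \<and> q = q'"
proof (induction ts arbitrary: c ts')
  case Nil
  then show ?case by (auto simp: steps_from_exit exit_eq_iff)
next
  case (Cons t ts)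
  then obtain d where d: "step M c t d" "steps M d ts (exit M w q)" by auto
  obtain t' us where ts': "ts' = t' # us"
    using Cons.prems(2) d(1) by (cases ts') (auto simp: step_from_exit)
  with Cons.prems(2) obtain d' where d': "step M c t' d'" "steps M d' us (exit M w' q')" by auto
  have "t = t'" "d = d'" using step_deterministic[OF assms d(1) d'(1)] by auto
  then show ?case using Cons.IH[OF d(2)] d'(2) ts' by auto
qed

text \<open>The mirror image: last steps are compared first, and an entry has no
  predecessor.\<close>

lemma steps_from_entry_unique:
  assumes "is_two_fa M" "codeterministic M"
  shows "steps M (entry M w q) ts c \<Longrightarrow> steps M (entry M w' q') ts' c \<Longrightarrow> w = w' \<and> q = q'"
proof (induction ts arbitrary: c ts' rule: rev_induct)
  case Nil
  then show ?case
    by (cases ts' rule: rev_cases) (auto simp: entry_eq_iff steps_append step_to_entry)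
next
  case (snoc t ts)
  then obtain d where d: "steps M (entry M w q) ts d" "step M d t c" by (auto simp: steps_append)
  obtain t' us where ts': "ts' = us @ [t']"
    using snoc.prems(2) d(2) by (cases ts' rule: rev_cases) (auto simp: step_to_entry)
  with snoc.prems(2) obtain d' where d': "steps M (entry M w' q') us d'" "step M d' t' c"
    by (auto simp: steps_append)
  have "d = d'" using step_codeterministic[OF assms d(2) d'(2)] by auto
  then show ?case using snoc.IH[OF d(1)] d'(1) by auto
qed

section \<open>Accepting runs as labelled paths\<close>

text \<open>\<open>step\<close> tests only membership in \<open>fwd_states\<close>; as the states
  are partitioned, failing this test means being a backward state.\<close>

lemma successor_iff_step:
  assumes "is_two_fa M"
  shows "successor M c c' \<longleftrightarrow> step M c (transition_between M c c') c'"
proof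
  assume "successor M c c'"
  moreover have "fwd_states M \<inter> bwd_states M = {}" using assms unfolding is_two_fa_def by blast
  ultimately show "step M c (transition_between M c c') c'"
    by (cases rule: successor.cases)
      (fastforce simp: step_def before_def after_def)+
next
  assume "step M c (transition_between M c c') c'"
  then obtain x a y p q where pq: "(p, a, q) \<in> transitions M"
    "c = before M x a y p" "c' = after M x a y q" by (elim stepE) auto
  moreover have "p \<in> states M" "q \<in> states M" using pq(1) assms unfolding is_two_fa_def by auto
  ultimately show "successor M c c'"
    by (auto simp: before_def after_def states_def intro: successor.intros)
qed

lemma step_transition_between: "step M c t c' \<Longrightarrow> transition_between M c c' = t"
  by (auto elim!: stepE simp: before_def after_def)

lemma run_output_Cons:
  "\<rho> \<noteq> [] \<Longrightarrow> run_output T (c # \<rho>) = out_word T (transition_between T c (hd \<rho>)) @ run_output T \<rho>"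
  by (cases \<rho>) (auto simp: run_output_def)

lemma steps_of_run:
  assumes "is_two_fa T"
  shows "\<rho> \<noteq> [] \<Longrightarrow> successively (successor T) \<rho> \<Longrightarrow>
    \<exists>ts. steps T (hd \<rho>) ts (last \<rho>) \<and> run_output T \<rho> = concat (map (out_word T) ts)"
proof (induction \<rho>)
  case Nil
  then show ?case by simp
next
  case (Cons c \<rho>)
  show ?case
  proof (cases "\<rho> = []")
    case True
    have "steps T (hd (c # \<rho>)) [] (last (c # \<rho>))" using True by simp
    moreover have "run_output T (c # \<rho>) = concat (map (out_word T) [])"
      using True by (simp add: run_output_def)
    ultimately show ?thesis by blast
  next
    case False
    with Cons obtain ts where ts: "steps T (hd \<rho>) ts (last \<rho>)"
      "run_output T \<rho> = concat (map (out_word T) ts)"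
      by (auto simp: successively_Cons)
    have "step T c (transition_between T c (hd \<rho>)) (hd \<rho>)"
      using Cons.prems False by (simp add: successively_Cons flip: successor_iff_step[OF assms])
    then have "steps T (hd (c # \<rho>)) (transition_between T c (hd \<rho>) # ts) (last (c # \<rho>))"
      using ts False by (auto intro!: steps_ConsI simp del: steps.simps)
    moreover have "run_output T (c # \<rho>)
        = concat (map (out_word T) (transition_between T c (hd \<rho>) # ts))"
      using ts False by (simp add: run_output_Cons)
    ultimately show ?thesis by blast
  qed
qed

lemma config_iff:
  "c \<in> configs M \<longleftrightarrow> tape c \<in> lists (marked_alphabet (alphabet M)) \<and> state c \<in> states M"
  by (cases c) (auto simp: configs_def)

lemma run_of_steps:
  assumes "is_two_fa T"
  shows "steps T c ts c' \<Longrightarrow> c \<in> configs T \<Longrightarrow>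
    \<exists>\<rho>. is_run T (tape c) \<rho> \<and> hd \<rho> = c \<and> last \<rho> = c' \<and> run_output T \<rho> = concat (map (out_word T) ts)"
proof (induction ts arbitrary: c)
  case Nil
  then show ?case by (intro exI[of _ "[c]"]) (auto simp: is_run_def run_output_def)
next
  case (Cons t ts)
  then obtain d where d: "step T c t d" "steps T d ts c'" by auto
  have "d \<in> configs T"
    using Cons.prems(2) step_states[OF assms d(1)] step_tape[OF d(1)] by (simp add: config_iff)
  from Cons.IH[OF d(2) this] obtain \<rho> where \<rho>: "is_run T (tape c) \<rho>" "hd \<rho> = d" "last \<rho> = c'"
    "run_output T \<rho> = concat (map (out_word T) ts)"
    using step_tape[OF d(1)] by auto
  have ne: "\<rho> \<noteq> []" using \<rho>(1) by (simp add: is_run_def)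
  have "successor T c d"
    using d(1) by (simp add: successor_iff_step[OF assms] step_transition_between)
  then have "is_run T (tape c) (c # \<rho>)"
    using \<rho>(1,2) Cons.prems(2) ne unfolding is_run_def by (cases c) (auto simp: successively_Cons)
  moreover have "run_output T (c # \<rho>) = concat (map (out_word T) (t # ts))"
    using ne \<rho>(2,4) step_transition_between[OF d(1)] by (simp add: run_output_Cons)
  ultimately show ?case using \<rho>(3) ne by (intro exI[of _ "c # \<rho>"]) auto
qed

text \<open>Passes from runs as lists of configurations to lists of transitions; all later arguments
  about transductions use this form.\<close>

lemma transduction_iff:
  assumes "is_two_fa T"
  shows "(u, v) \<in> transduction T \<longleftrightarrow> u \<in> lists (alphabet T) \<and>
    (\<exists>ts. steps T (entry T (mark_word u) (initial T)) ts (exit T (mark_word u) (final T)) \<and>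
      v = concat (map (out_word T) ts))"
    (is "_ \<longleftrightarrow> _ \<and> ?P")
proof -
  have ends: "initial T \<in> fwd_states T" "final T \<in> fwd_states T"
    using assms unfolding is_two_fa_def by auto
  have "(\<exists>\<rho>. accepting_run T (mark_word u) \<rho> \<and> v = run_output T \<rho>) \<longleftrightarrow> ?P"
    if u: "u \<in> lists (alphabet T)"
  proof
    assume "\<exists>\<rho>. accepting_run T (mark_word u) \<rho> \<and> v = run_output T \<rho>"
    then obtain \<rho> where \<rho>: "is_run T (mark_word u) \<rho>" "hd \<rho> = ([], initial T, mark_word u)"
      "last \<rho> = (mark_word u, final T, [])" "v = run_output T \<rho>"
      unfolding accepting_run_def by blast
    then have "\<rho> \<noteq> []" "successively (successor T) \<rho>" by (simp_all add: is_run_def)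
    from steps_of_run[OF assms this] show ?P using \<rho> ends by (auto simp: entry_def exit_def)
  next
    assume ?P
    then obtain ts where ts: "steps T (entry T (mark_word u) (initial T)) ts
        (exit T (mark_word u) (final T))" "v = concat (map (out_word T) ts)"
      by blast
    have "entry T (mark_word u) (initial T) \<in> configs T"
      using u ends unfolding config_iff
      by (auto simp: states_def mark_word_def marked_alphabet_def)
    from run_of_steps[OF assms ts(1) this]
    show "\<exists>\<rho>. accepting_run T (mark_word u) \<rho> \<and> v = run_output T \<rho>"
      using ts(2) ends by (auto simp: accepting_run_def entry_def exit_def)
  qed
  then show ?thesis unfolding transduction_def by auto
qed

section \<open>Positions of the endmarkers in a marked word\<close>

lemma mark_word_LeftEnd:
  assumes "x @ LeftEnd # y = mark_word u"
  shows "x = []"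
proof (rule ccontr)
  assume "x \<noteq> []"
  then have "LeftEnd \<in> set (tl (x @ LeftEnd # y))" by (cases x) auto
  then show False unfolding assms mark_word_def by auto
qed

lemma mark_word_RightEnd:
  assumes "x @ RightEnd # y = mark_word u"
  shows "y = []"
proof (rule ccontr)
  assume "y \<noteq> []"
  then have "RightEnd \<in> set (butlast (x @ RightEnd # y))" by (simp add: butlast_append)
  then show False unfolding assms mark_word_def by (auto simp: butlast_append)
qed

lemma mark_word_prefix_empty_iff: "x @ a # y = mark_word u \<Longrightarrow> x = [] \<longleftrightarrow> a = LeftEnd"
  using mark_word_LeftEnd[of x y u] unfolding mark_word_def by (cases x) auto

lemma mark_word_suffix_empty_iff:
  assumes "x @ a # y = mark_word u"
  shows "y = [] \<longleftrightarrow> a = RightEnd"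
proof
  assume "y = []"
  then have "a = last (mark_word u)" using assms by (metis last_snoc)
  then show "a = RightEnd" by (simp add: mark_word_def)
next
  assume "a = RightEnd"
  then show "y = []" using assms mark_word_RightEnd by metis
qed

section \<open>Removing endmarker transitions that no accepting run uses\<close>

text \<open>With these transitions present, pairs of backward states, which are forward in the product,
  would violate the endmarker conventions of two-way automata.\<close>

definition trim :: "('a, 'q, 'z) two_fa_scheme \<Rightarrow> ('a, 'q, 'z) two_fa_scheme" where
  "trim M = M\<lparr>transitions := {(p, a, q) \<in> transitions M.
     (a = LeftEnd \<longrightarrow> q \<in> fwd_states M) \<and> (a = RightEnd \<longrightarrow> p \<in> fwd_states M)}\<rparr>"

lemma trim_simps [simp]:
  "alphabet (trim M) = alphabet M" "fwd_states (trim M) = fwd_states M"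
  "bwd_states (trim M) = bwd_states M" "initial (trim M) = initial M" "final (trim M) = final M"
  "states (trim M) = states M"
  "before (trim M) = before M" "after (trim M) = after M"
  "entry (trim M) = entry M" "exit (trim M) = exit M"
  by (auto simp: trim_def states_def before_def after_def entry_def exit_def fun_eq_iff)

lemma trim_out_simps [simp]: "out_alphabet (trim T) = out_alphabet T" "out_word (trim T) = out_word T"
  by (simp_all add: trim_def)

lemma transitions_trim: "transitions (trim M) = {(p, a, q) \<in> transitions M.
     (a = LeftEnd \<longrightarrow> q \<in> fwd_states M) \<and> (a = RightEnd \<longrightarrow> p \<in> fwd_states M)}"
  by (simp add: trim_def)

lemma is_two_ft_trim: "is_two_ft T \<Longrightarrow> is_two_ft (trim T)"
  unfolding is_two_ft_def is_two_fa_def by (simp add: transitions_trim) blast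

lemma reversible_trim: "reversible M \<Longrightarrow> reversible (trim M)"
  unfolding reversible_def deterministic_def codeterministic_def Uniq_def
  by (simp add: transitions_trim)

lemma steps_of_trim: "steps (trim M) c ts c' \<Longrightarrow> steps M c ts c'"
proof (induction ts arbitrary: c)
  case (Cons t ts)
  then obtain d where "step (trim M) c t d" "steps M d ts c'" by auto
  moreover from this have "step M c t d"
    unfolding step_def transitions_trim by (simp, blast)
  ultimately show ?case by (intro steps_ConsI)
qed simp

text \<open>A removed transition on \<open>LeftEnd\<close> ends in a backward state at the left
  border, an exit, so it could only come last. A removed transition on \<open>RightEnd\<close>
  starts in a backward state at the right border, an entry, so it could only come first. The last
  two premises exclude both.\<close>

lemma trim_steps:
  "steps M c ts c' \<Longrightarrow> tape c = mark_word u \<Longrightarrow>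
    (\<And>q. q \<notin> fwd_states M \<Longrightarrow> c \<noteq> entry M (mark_word u) q) \<Longrightarrow>
    (\<And>q. q \<notin> fwd_states M \<Longrightarrow> c' \<noteq> exit M (mark_word u) q) \<Longrightarrow> steps (trim M) c ts c'"
proof (induction ts arbitrary: c)
  case (Cons t ts)
  then obtain d where d: "step M c t d" "steps M d ts c'" by auto
  have "steps (trim M) d ts c'"
    using Cons.IH[OF d(2)] Cons.prems(2,4) step_tape[OF d(1)] step_to_entry d(1) by metis
  moreover have "step (trim M) c t d"
  proof -
    from d(1) obtain x a y p q where t: "t = (p, a, q)" "(p, a, q) \<in> transitions M"
      and c: "c = before M x a y p" and d': "d = after M x a y q"
      by (rule stepE)
    have w: "x @ a # y = mark_word u" using Cons.prems(2) c by simp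
    have "q \<in> fwd_states M" if "a = LeftEnd"
    proof (rule ccontr)
      assume q: "q \<notin> fwd_states M"
      have "d = exit M (mark_word u) q"
        using that q w d' mark_word_LeftEnd[of x y u] by (simp add: after_def exit_def)
      then show False using d(2) Cons.prems(4)[OF q] by (simp add: steps_from_exit)
    qed
    moreover have "p \<in> fwd_states M" if "a = RightEnd"
    proof (rule ccontr)
      assume p: "p \<notin> fwd_states M"
      have "y = []" using that w mark_word_RightEnd by metis
      then have "c = entry M (mark_word u) p"
        using that p w c by (simp add: before_def entry_def)
      then show False using Cons.prems(3)[OF p] by simp
    qed
    ultimately show ?thesis
      using t c d' unfolding step_def transitions_trim by (auto 0 3)
  qed
  ultimately show ?case by (intro steps_ConsI)
qed simp

lemma transduction_trim:
  assumes "is_two_ft T"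
  shows "transduction (trim T) = transduction T"
proof -
  have fa: "is_two_fa T" "is_two_fa (trim T)"
    using assms is_two_ft_trim by (auto simp: is_two_ft_def)
  have ends: "initial T \<in> fwd_states T" "final T \<in> fwd_states T"
    using fa(1) unfolding is_two_fa_def by auto
  have "steps (trim T) (entry T (mark_word u) (initial T)) ts (exit T (mark_word u) (final T)) \<longleftrightarrow>
    steps T (entry T (mark_word u) (initial T)) ts (exit T (mark_word u) (final T))" for u ts
    using ends by (auto intro!: trim_steps dest: steps_of_trim simp: entry_eq_iff exit_eq_iff)
  then show ?thesis
    by (auto simp: transduction_iff[OF fa(1)] transduction_iff[OF fa(2)])
qed

section \<open>The composed transducer\<close>

fun pair :: "('a, 'p) config \<Rightarrow> 'q \<Rightarrow> ('a, 'p \<times> 'q) config" where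
  "pair (u, p, v) q = (u, (p, q), v)"

lemma pair_inject: "pair c q = pair c' q' \<longleftrightarrow> c = c' \<and> q = q'"
  by (cases c; cases c') auto

locale composition =
  fixes T1 :: "('a, 'q1, 'b) two_ft" and T2 :: "('b, 'q2, 'c) two_ft"
  assumes ft1: "is_two_ft T1" and rev1: "reversible T1"
    and ft2: "is_two_ft T2" and rev2: "reversible T2"
    and alphabets: "out_alphabet T1 = alphabet T2"
    and LeftEnd_into_fwd: "(p, LeftEnd, p') \<in> transitions T1 \<Longrightarrow> p' \<in> fwd_states T1"
    and RightEnd_from_fwd: "(p, RightEnd, p') \<in> transitions T1 \<Longrightarrow> p \<in> fwd_states T1"
begin

lemma fa1: "is_two_fa T1" and fa2: "is_two_fa T2"
  using ft1 ft2 by (auto simp: is_two_ft_def)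

lemma det1: "deterministic T1" and codet1: "codeterministic T1"
  and det2: "deterministic T2" and codet2: "codeterministic T2"
  using rev1 rev2 by (auto simp: reversible_def)

lemma ends:
  "initial T1 \<in> fwd_states T1" "final T1 \<in> fwd_states T1"
  "initial T2 \<in> fwd_states T2" "final T2 \<in> fwd_states T2"
  using fa1 fa2 unfolding is_two_fa_def by auto

text \<open>The tests for forward states keep a mere turn at an endmarker from emitting one: a
  backward state reading \<open>LeftEnd\<close> is not starting the run, and a transition on
  \<open>RightEnd\<close> into a backward state is not ending it.\<close>

fun segment :: "('a, 'q1) transition \<Rightarrow> 'b marked list" where
  "segment (p, a, p') =
     (if a = LeftEnd \<and> p \<in> fwd_states T1 then [LeftEnd] else []) @
     map Letter (out_word T1 (p, a, p')) @
     (if a = RightEnd \<and> p' \<in> fwd_states T1 then [RightEnd] else [])"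

text \<open>If \<open>segment t\<close> is empty, entry and exit coincide, so \<open>ts = []\<close>
  and \<open>q' = q\<close>: \<open>T2\<close> passes through without changing state or
  direction.\<close>

definition traversal :: "('a, 'q1) transition \<Rightarrow> 'q2 \<Rightarrow> ('b, 'q2) transition list \<Rightarrow> 'q2 \<Rightarrow> bool" where
  "traversal t q ts q' \<longleftrightarrow> t \<in> transitions T1 \<and> q \<in> states T2 \<and>
     steps T2 (entry T2 (segment t) q) ts (exit T2 (segment t) q')"

text \<open>A backward \<open>q\<close> enters the output of \<open>t\<close> from its right end,
  where \<open>T1\<close> is already in \<open>p'\<close>; a backward \<open>q'\<close> leaves at
  the left end, where \<open>T1\<close> is still in \<open>p\<close>.\<close>

fun product_transition :: "('a, 'q1) transition \<Rightarrow> 'q2 \<Rightarrow> 'q2 \<Rightarrow> ('a, 'q1 \<times> 'q2) transition" where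
  "product_transition (p, a, p') q q' =
     ((if q \<in> fwd_states T2 then p else p', q), a, (if q' \<in> fwd_states T2 then p' else p, q'))"

text \<open>While \<open>T2\<close> moves backward, \<open>T1\<close> is undone, and the transition
  leading into \<open>p\<close> read the letter on the side that \<open>p\<close> does not face.
  Hence a pair faces right exactly if its components have the same direction. The description in
  \<open>out_word\<close> is shown to be unique in \<open>out_word_T3\<close>.\<close>

definition T3 :: "('a, 'q1 \<times> 'q2, 'c) two_ft" where
  "T3 = \<lparr>alphabet = alphabet T1,
     fwd_states = {(p, q) \<in> states T1 \<times> states T2. p \<in> fwd_states T1 \<longleftrightarrow> q \<in> fwd_states T2},
     bwd_states = {(p, q) \<in> states T1 \<times> states T2. p \<in> fwd_states T1 \<longleftrightarrow> q \<notin> fwd_states T2},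
     initial = (initial T1, initial T2), final = (final T1, final T2),
     transitions = {product_transition t q q' | t q ts q'. traversal t q ts q'},
     out_alphabet = out_alphabet T2,
     out_word = (\<lambda>\<tau>. concat (map (out_word T2)
       (THE ts. \<exists>t q q'. \<tau> = product_transition t q q' \<and> traversal t q ts q')))\<rparr>"

lemma T3_simps [simp]:
  "alphabet T3 = alphabet T1" "out_alphabet T3 = out_alphabet T2"
  "initial T3 = (initial T1, initial T2)" "final T3 = (final T1, final T2)"
  "states T3 = states T1 \<times> states T2"
  by (auto simp: T3_def states_def)

lemma fwd_T3: "(p, q) \<in> fwd_states T3 \<longleftrightarrow>
    p \<in> states T1 \<and> q \<in> states T2 \<and> (p \<in> fwd_states T1 \<longleftrightarrow> q \<in> fwd_states T2)"
  by (auto simp: T3_def)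

lemma transitions_T3: "transitions T3 = {product_transition t q q' | t q ts q'. traversal t q ts q'}"
  by (simp add: T3_def)

lemma traversal_states:
  assumes "traversal (p, a, p') q ts q'"
  shows "p \<in> states T1" "a \<in> marked_alphabet (alphabet T1)" "p' \<in> states T1"
    "q \<in> states T2" "q' \<in> states T2"
proof -
  have "(p, a, p') \<in> transitions T1" using assms by (simp add: traversal_def)
  then show "p \<in> states T1" "a \<in> marked_alphabet (alphabet T1)" "p' \<in> states T1"
    using fa1 unfolding is_two_fa_def by blast+
  show "q \<in> states T2" using assms by (simp add: traversal_def)
  then show "q' \<in> states T2"
    using assms steps_states[OF fa2] unfolding traversal_def by (metis state_simps(3,4))
qed

section \<open>Reversibility of the composed transducer\<close>

lemma traversal_deterministic:
  assumes "traversal t q ts q'" "traversal t q us r'"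
  shows "ts = us \<and> q' = r'"
  using assms steps_to_exit_unique[OF fa2 det2] unfolding traversal_def by metis

lemma traversal_codeterministic:
  assumes "traversal t q ts q'" "traversal t r us q'"
  shows "q = r"
  using assms steps_from_entry_unique[OF fa2 codet2] unfolding traversal_def by metis

text \<open>The source \<open>P\<close> contains \<open>q\<close>. If \<open>q\<close> is forward,
  \<open>P\<close> also contains the source of \<open>t\<close>, so determinism of \<open>T1\<close>
  yields \<open>t\<close>; otherwise it contains the target of \<open>t\<close>, and co-determinism
  does. Then determinism of \<open>T2\<close> fixes the traversal.\<close>

lemma product_transition_deterministic:
  assumes "traversal t q ts q'" "traversal s r us r'"
    and "product_transition t q q' = (P, a, Q)" "product_transition s r r' = (P, a, Q')"
  shows "t = s \<and> q = r \<and> ts = us \<and> q' = r'"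
proof -
  obtain p1 p2 s1 s2 where ts: "t = (p1, a, p2)" "s = (s1, a, s2)"
    using assms(3,4) by (cases t; cases s) auto
  have "q = r" using assms(3,4) ts by auto
  moreover have "t = s"
    using assms ts \<open>q = r\<close>
    by (auto simp: traversal_def split: if_splits
        dest: deterministicD[OF fa1 det1] codeterministicD[OF fa1 codet1])
  ultimately show ?thesis using traversal_deterministic assms(1,2) by metis
qed

text \<open>The same with the target: a forward \<open>q'\<close> comes with the target of
  \<open>t\<close>, any other with its source. Both properties of \<open>T1\<close> are used again,
  then co-determinism of \<open>T2\<close>.\<close>

lemma product_transition_codeterministic:
  assumes "traversal t q ts q'" "traversal s r us r'"
    and "product_transition t q q' = (P, a, Q)" "product_transition s r r' = (P', a, Q)"
  shows "t = s \<and> q = r"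
proof -
  obtain p1 p2 s1 s2 where ts: "t = (p1, a, p2)" "s = (s1, a, s2)"
    using assms(3,4) by (cases t; cases s) auto
  have "q' = r'" using assms(3,4) ts by auto
  moreover have "t = s"
    using assms ts \<open>q' = r'\<close>
    by (auto simp: traversal_def split: if_splits
        dest: deterministicD[OF fa1 det1] codeterministicD[OF fa1 codet1])
  ultimately show ?thesis using traversal_codeterministic assms(1,2) by metis
qed

lemma out_word_T3:
  assumes "traversal t q ts q'"
  shows "out_word T3 (product_transition t q q') = concat (map (out_word T2) ts)"
proof -
  have "(THE us. \<exists>s r r'. product_transition t q q' = product_transition s r r' \<and>
      traversal s r us r') = ts"
  proof (rule the_equality)
    show "\<exists>s r r'. product_transition t q q' = product_transition s r r' \<and> traversal s r ts r'"
      using assms by blast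
  next
    fix us
    assume "\<exists>s r r'. product_transition t q q' = product_transition s r r' \<and> traversal s r us r'"
    then show "us = ts" using product_transition_deterministic assms by (metis prod_cases3)
  qed
  then show ?thesis by (simp add: T3_def)
qed

lemma reversible_T3: "reversible T3"
proof -
  have "Q = Q'" if "(P, a, Q) \<in> transitions T3" "(P, a, Q') \<in> transitions T3" for P a Q Q'
  proof -
    from that obtain t q ts q' s r us r' where *: "traversal t q ts q'" "traversal s r us r'"
      "(P, a, Q) = product_transition t q q'" "(P, a, Q') = product_transition s r r'"
      unfolding transitions_T3 by blast
    from product_transition_deterministic[OF *(1,2) *(3,4)[symmetric]] *(3,4)
    show ?thesis by (metis prod.inject)
  qed
  moreover have "P = P'" if "(P, a, Q) \<in> transitions T3" "(P', a, Q) \<in> transitions T3" for P P' a Q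
  proof -
    from that obtain t q ts q' s r us r' where *: "traversal t q ts q'" "traversal s r us r'"
      "(P, a, Q) = product_transition t q q'" "(P', a, Q) = product_transition s r r'"
      unfolding transitions_T3 by blast
    from product_transition_codeterministic[OF *(1,2) *(3,4)[symmetric]] *(3,4)
    show ?thesis by (cases t; cases s) auto
  qed
  ultimately show ?thesis
    unfolding reversible_def deterministic_def codeterministic_def Uniq_def by blast
qed

section \<open>Endmarker conventions of the composed transducer\<close>

lemma initial_T3:
  assumes "(P, LeftEnd, Q) \<in> transitions T3" "P \<in> fwd_states T3"
  shows "P = initial T3"
proof -
  from assms(1) obtain p p' q ts q' where tr: "traversal (p, LeftEnd, p') q ts q'"
    and P: "P = (if q \<in> fwd_states T2 then p else p', q)"
    unfolding transitions_T3 by auto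
  have t: "(p, LeftEnd, p') \<in> transitions T1" using tr by (simp add: traversal_def)
  have p': "p' \<in> fwd_states T1" using t by (rule LeftEnd_into_fwd)
  \<comment> \<open>Otherwise \<open>P = (p', q)\<close> would pair a forward with a backward state
    and thus be backward.\<close>
  have q: "q \<in> fwd_states T2" using P p' assms(2) by (auto simp: fwd_T3 split: if_splits)
  have p: "p \<in> fwd_states T1" using P q assms(2) by (auto simp: fwd_T3)
  have "p = initial T1" using t p fa1 unfolding is_two_fa_def by blast
  obtain w where w: "segment (p, LeftEnd, p') = LeftEnd # w" using p by simp
  have st: "steps T2 ([], q, LeftEnd # w) ts (exit T2 (LeftEnd # w) q')"
    using tr w q by (simp add: traversal_def entry_def)
  \<comment> \<open>The segment starts with \<open>LeftEnd\<close>, so it is not empty and the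
    traversal has a first step, which reads this endmarker.\<close>
  then obtain t ts' d where "step T2 ([], q, LeftEnd # w) t d"
    using q by (cases ts) (auto simp: exit_def split: if_splits)
  then obtain r where "(q, LeftEnd, r) \<in> transitions T2"
    by (elim stepE) (auto simp: before_def split: if_splits)
  then have "q = initial T2" using q fa2 unfolding is_two_fa_def by blast
  then show ?thesis using P q \<open>p = initial T1\<close> by simp
qed

lemma final_T3:
  assumes "(P, RightEnd, Q) \<in> transitions T3" "Q \<in> fwd_states T3"
  shows "Q = final T3"
proof -
  from assms(1) obtain p p' q ts q' where tr: "traversal (p, RightEnd, p') q ts q'"
    and Q: "Q = (if q' \<in> fwd_states T2 then p' else p, q')"
    unfolding transitions_T3 by auto
  have t: "(p, RightEnd, p') \<in> transitions T1" using tr by (simp add: traversal_def)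
  have p: "p \<in> fwd_states T1" using t by (rule RightEnd_from_fwd)
  \<comment> \<open>Otherwise \<open>Q = (p, q')\<close> with \<open>p\<close> forward would be a
    backward state.\<close>
  have q': "q' \<in> fwd_states T2" using Q p assms(2) by (auto simp: fwd_T3 split: if_splits)
  have p': "p' \<in> fwd_states T1" using Q q' assms(2) by (auto simp: fwd_T3)
  have "p' = final T1" using t p' fa1 unfolding is_two_fa_def by blast
  obtain w where w: "segment (p, RightEnd, p') = w @ [RightEnd]" using p' by simp
  have st: "steps T2 (entry T2 (w @ [RightEnd]) q) ts (w @ [RightEnd], q', [])"
    using tr w q' by (simp add: traversal_def exit_def)
  then obtain t d where "step T2 d t (w @ [RightEnd], q', [])"
    using q' by (cases ts rule: rev_cases) (auto simp: entry_def steps_append split: if_splits)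
  then obtain r where "(r, RightEnd, q') \<in> transitions T2"
    by (elim stepE) (auto simp: after_def split: if_splits)
  then have "q' = final T2" using q' fa2 unfolding is_two_fa_def by blast
  then show ?thesis using Q q' \<open>p' = final T1\<close> by simp
qed

lemma is_two_ft_T3: "is_two_ft T3"
proof -
  have "finite (states T1)" "finite (states T2)"
    using fa1 fa2 by (auto simp: is_two_fa_def states_def)
  then have "finite (states T3)" by simp
  then have fin: "finite (fwd_states T3)" "finite (bwd_states T3)"
    unfolding states_def[of T3] by simp_all
  have sub: "transitions T3 \<subseteq> states T3 \<times> marked_alphabet (alphabet T3) \<times> states T3"
  proof
    fix \<tau> assume "\<tau> \<in> transitions T3"
    then obtain p a p' q ts q' where *: "\<tau> = product_transition (p, a, p') q q'"
      "traversal (p, a, p') q ts q'"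
      unfolding transitions_T3 by auto
    show "\<tau> \<in> states T3 \<times> marked_alphabet (alphabet T3) \<times> states T3"
      using traversal_states[OF *(2)] by (simp add: *(1))
  qed
  have "out_word T3 \<tau> \<in> lists (out_alphabet T3)" if \<tau>: "\<tau> \<in> transitions T3" for \<tau>
  proof -
    obtain t q ts q' where *: "\<tau> = product_transition t q q'" "traversal t q ts q'"
      using \<tau> unfolding transitions_T3 by blast
    have "set ts \<subseteq> transitions T2" using *(2) by (auto simp: traversal_def dest: steps_transitions)
    then show ?thesis using ft2 unfolding *(1) out_word_T3[OF *(2)] is_two_ft_def by fastforce
  qed
  moreover have "is_two_fa T3"
    unfolding is_two_fa_def
  proof (intro conjI allI impI)
    show "finite (alphabet T3)" using fa1 by (simp add: is_two_fa_def)
    show "fwd_states T3 \<inter> bwd_states T3 = {}" by (auto simp: T3_def)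
    show "initial T3 \<in> fwd_states T3" "final T3 \<in> fwd_states T3"
      using ends by (simp_all add: fwd_T3 states_def)
  qed (use fin sub initial_T3 final_T3 in blast)+
  ultimately show ?thesis using ft2 by (simp add: is_two_ft_def)
qed

text \<open>For a backward \<open>q\<close> the letter is about to be read by undoing a transition
  of \<open>T1\<close>, so \<open>T1\<close> is in the configuration after that letter.\<close>

lemma before_T3:
  assumes "p \<in> states T1" "q \<in> states T2"
  shows "before T3 x a y (p, q) =
    pair (if q \<in> fwd_states T2 then before T1 x a y p else after T1 x a y p) q"
  using assms by (simp add: before_def after_def fwd_T3)

lemma after_T3:
  assumes "p \<in> states T1" "q \<in> states T2"
  shows "after T3 x a y (p, q) =
    pair (if q \<in> fwd_states T2 then after T1 x a y p else before T1 x a y p) q"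
  using assms by (simp add: before_def after_def fwd_T3)

lemma step_T3_I:
  assumes "step T1 c t c'" "traversal t q ts q'"
  shows "step T3 (pair (if q \<in> fwd_states T2 then c else c') q) (product_transition t q q')
    (pair (if q' \<in> fwd_states T2 then c' else c) q')"
proof -
  from assms(1) obtain x a y p p' where t: "t = (p, a, p')"
    and c: "c = before T1 x a y p" "c' = after T1 x a y p'"
    by (rule stepE)
  note st = traversal_states[OF assms(2)[unfolded t]]
  have "product_transition t q q' \<in> transitions T3" using assms(2) unfolding transitions_T3 by blast
  then show ?thesis using st unfolding c t by (auto dest!: stepI simp: before_T3 after_T3)
qed

text \<open>With \<open>step_T3_I\<close>, this reduces a step of \<open>T3\<close> to a step of
  \<open>T1\<close> and a traversal of its segment: the directions of \<open>q\<close> and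
  \<open>q'\<close> tell at which end of the step the simulation starts and stops.\<close>

lemma step_T3_E:
  assumes "step T3 C \<tau> C'"
  obtains c t c' q ts q' where "step T1 c t c'" "traversal t q ts q'" "\<tau> = product_transition t q q'"
    "C = pair (if q \<in> fwd_states T2 then c else c') q"
    "C' = pair (if q' \<in> fwd_states T2 then c' else c) q'"
proof -
  from assms obtain x a y P Q where \<tau>: "\<tau> = (P, a, Q)" "(P, a, Q) \<in> transitions T3"
    and C: "C = before T3 x a y P" "C' = after T3 x a y Q"
    by (rule stepE)
  from \<tau>(2) obtain p p' q ts q' where tr: "traversal (p, a, p') q ts q'"
    and P: "P = (if q \<in> fwd_states T2 then p else p', q)"
    and Q: "Q = (if q' \<in> fwd_states T2 then p' else p, q')"
    unfolding transitions_T3 by auto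
  have "step T1 (before T1 x a y p) (p, a, p') (after T1 x a y p')"
    using tr by (intro stepI) (simp add: traversal_def)
  moreover note tr
  moreover have "\<tau> = product_transition (p, a, p') q q'" using \<tau>(1) P Q by simp
  moreover have "C = pair (if q \<in> fwd_states T2 then before T1 x a y p else after T1 x a y p') q"
    "C' = pair (if q' \<in> fwd_states T2 then after T1 x a y p' else before T1 x a y p) q'"
    using C P Q traversal_states[OF tr] by (auto simp: before_T3 after_T3)
  ultimately show thesis by (rule that)
qed

section \<open>Correctness\<close>

abbreviation segments :: "('a, 'q1) transition list \<Rightarrow> 'b marked list" where
  "segments ts \<equiv> concat (map segment ts)"

abbreviation out1 :: "('a, 'q1) transition list \<Rightarrow> 'b list" where
  "out1 ts \<equiv> concat (map (out_word T1) ts)"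

abbreviation out2 :: "('b, 'q2) transition list \<Rightarrow> 'c list" where
  "out2 ts \<equiv> concat (map (out_word T2) ts)"

abbreviation out3 :: "('a, 'q1 \<times> 'q2) transition list \<Rightarrow> 'c list" where
  "out3 ts \<equiv> concat (map (out_word T3) ts)"

text \<open>Entries have no predecessor and exits no successor, so only the first transition can
  emit the left endmarker and only the last one the right. The tests \<open>ts \<noteq> []\<close>
  are there because an empty path emits nothing even at a border.\<close>

lemma segments_eq:
  "steps T1 c ts c' \<Longrightarrow> tape c = mark_word u \<Longrightarrow> segments ts =
    (if ts \<noteq> [] \<and> (\<exists>p \<in> fwd_states T1. c = entry T1 (mark_word u) p) then [LeftEnd] else []) @
    map Letter (out1 ts) @
    (if ts \<noteq> [] \<and> (\<exists>p \<in> fwd_states T1. c' = exit T1 (mark_word u) p) then [RightEnd] else [])"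
proof (induction ts arbitrary: c)
  case (Cons t ts)
  then obtain d where d: "step T1 c t d" "steps T1 d ts c'" by auto
  obtain x a y p p' where t: "t = (p, a, p')"
    and c: "c = before T1 x a y p" and d': "d = after T1 x a y p'"
    using d(1) by (rule stepE)
  have w: "x @ a # y = mark_word u" using Cons.prems(2) c by simp
  have left: "(\<exists>p \<in> fwd_states T1. c = entry T1 (mark_word u) p) \<longleftrightarrow> a = LeftEnd \<and> p \<in> fwd_states T1"
    using mark_word_prefix_empty_iff[OF w] w by (auto simp: c before_def entry_def)
  have right: "(\<exists>p \<in> fwd_states T1. d = exit T1 (mark_word u) p) \<longleftrightarrow> a = RightEnd \<and> p' \<in> fwd_states T1"
    using mark_word_suffix_empty_iff[OF w] w by (auto simp: d' after_def exit_def)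
  have dl: "\<not> (\<exists>p \<in> fwd_states T1. d = entry T1 (mark_word u) p)"
    using step_to_entry d(1) by metis
  have "ts = [] \<and> c' = d" if "\<exists>p \<in> fwd_states T1. d = exit T1 (mark_word u) p"
    using that d(2) by (auto simp: steps_from_exit)
  moreover have "c' = d" if "ts = []" using d(2) that by simp
  ultimately show ?case
    using Cons.IH[OF d(2)] step_tape[OF d(1)] Cons.prems(2) left right dl t
    by (cases "ts = []") auto
qed simp

lemma segments_accepting:
  assumes "steps T1 (entry T1 (mark_word u) (initial T1)) ts (exit T1 (mark_word u) (final T1))"
  shows "segments ts = mark_word (out1 ts)"
proof -
  have "ts \<noteq> []" using assms ends by (auto simp: entry_def exit_def mark_word_def)
  moreover have "\<exists>p \<in> fwd_states T1. entry T1 (mark_word u) (initial T1) = entry T1 (mark_word u) p"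
    "\<exists>p \<in> fwd_states T1. exit T1 (mark_word u) (final T1) = exit T1 (mark_word u) p"
    using ends by auto
  ultimately show ?thesis using segments_eq[OF assms] unfolding mark_word_def by auto
qed

text \<open>The run of \<open>T1\<close> has to be recorded beyond the current configuration, up to the furthest point \<open>e\<close>
  reached so far: \<open>T2\<close> may already have read the output \<open>segments us\<close> to the right of its head.\<close>

lemma steps_T3_sound:
  assumes "steps T3 (pair (entry T1 w p0) (initial T2)) \<tau>s C"
  shows "\<exists>ts us c e q zs. C = pair c q \<and> q \<in> states T2 \<and>
    steps T1 (entry T1 w p0) ts c \<and> steps T1 c us e \<and>
    steps T2 (entry T2 (segments ts @ segments us) (initial T2)) zs (segments ts, q, segments us) \<and>
    out3 \<tau>s = out2 zs"
  using assms
proof (induction \<tau>s arbitrary: C rule: rev_induct)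
  case Nil
  have "steps T1 (entry T1 w p0) [] (entry T1 w p0)"
    "steps T2 (entry T2 (segments [] @ segments []) (initial T2)) [] (segments [], initial T2, segments [])"
    "initial T2 \<in> states T2" "out3 [] = out2 []"
    using ends by (simp_all add: entry_def states_def)
  with Nil show ?case by (metis steps.simps(1))
next
  case (snoc \<tau> \<tau>s)
  then obtain D where "steps T3 (pair (entry T1 w p0) (initial T2)) \<tau>s D" and st: "step T3 D \<tau> C"
    by (auto simp: steps_append)
  from snoc.IH[OF this(1)] obtain ts us c e q zs where D: "D = pair c q"
    and ts: "steps T1 (entry T1 w p0) ts c" and us: "steps T1 c us e"
    and zs: "steps T2 (entry T2 (segments ts @ segments us) (initial T2)) zs
      (segments ts, q, segments us)"
    and out: "out3 \<tau>s = out2 zs"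
    by blast
  from st obtain c1 t c2 r vs q' where t: "step T1 c1 t c2" and tr: "traversal t r vs q'"
    and \<tau>: "\<tau> = product_transition t r q'"
    and Dr: "D = pair (if r \<in> fwd_states T2 then c1 else c2) r"
    and C: "C = pair (if q' \<in> fwd_states T2 then c2 else c1) q'"
    by (rule step_T3_E)
  have r: "r = q" and cq: "c = (if q \<in> fwd_states T2 then c1 else c2)"
    using D Dr by (auto simp: pair_inject)
  \<comment> \<open>The record is rearranged around \<open>t\<close>, so that \<open>T2\<close>
    stands at the entry of \<open>segment t\<close> as a factor of its tape.\<close>
  have "\<exists>xs ys d. steps T1 (entry T1 w p0) xs c1 \<and> steps T1 c2 ys d \<and>
    steps T2 (entry T2 (segments xs @ segment t @ segments ys) (initial T2)) zs
      (lift (segments xs) (segments ys) (entry T2 (segment t) q))"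
  proof (cases "q \<in> fwd_states T2")
    case True
    show ?thesis
    proof (cases us)
      case Nil
      \<comment> \<open>\<open>T2\<close> has used up the recorded output. The record grows by
        \<open>t\<close>, and the run of \<open>T2\<close> so far stays valid on the tape extended
        to the right.\<close>
      have "steps T2 (entry T2 (segments ts @ segment t) (initial T2)) zs (segments ts, q, segment t)"
        using steps_lift[OF zs, of "[]" "segment t"] Nil ends by (simp add: entry_def)
      moreover have "steps T1 c2 [] c2" by simp
      ultimately show ?thesis using ts cq True
        by (intro exI[of _ ts] exI[of _ "[]"] exI[of _ c2]) (simp add: entry_def)
    next
      case (Cons t' ys)
      with us obtain d where d: "step T1 c t' d" "steps T1 d ys e" by auto
      have "t' = t" "d = c2" using step_deterministic[OF fa1 det1 d(1)] t cq True by auto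
      then show ?thesis using ts zs cq True d(2) Cons
        by (intro exI[of _ ts] exI[of _ ys] exI[of _ e]) (simp add: entry_def)
    qed
  next
    case False
    then have c: "c = c2" using cq by simp
    \<comment> \<open>A configuration reached by a step is not an entry, so something is recorded on
      the left; by co-determinism its last transition is \<open>t\<close>.\<close>
    obtain t' xs where xs: "ts = xs @ [t']"
      using ts t c by (cases ts rule: rev_cases) (auto simp: step_to_entry)
    with ts obtain d where d: "steps T1 (entry T1 w p0) xs d" "step T1 d t' c"
      by (auto simp: steps_append)
    have "t' = t" "d = c1" using step_codeterministic[OF fa1 codet1 d(2)] t c by auto
    then show ?thesis using us zs c False d(1) xs
      by (intro exI[of _ xs] exI[of _ us] exI[of _ e]) (simp add: entry_def)
  qed
  then obtain xs ys d where xs: "steps T1 (entry T1 w p0) xs c1" and ys: "steps T1 c2 ys d"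
    and zs': "steps T2 (entry T2 (segments xs @ segment t @ segments ys) (initial T2)) zs
      (lift (segments xs) (segments ys) (entry T2 (segment t) q))"
    by blast
  have "steps T2 (lift (segments xs) (segments ys) (entry T2 (segment t) q)) vs
      (lift (segments xs) (segments ys) (exit T2 (segment t) q'))"
    using tr r by (intro steps_lift) (simp add: traversal_def)
  with zs' have vs: "steps T2 (entry T2 (segments xs @ segment t @ segments ys) (initial T2)) (zs @ vs)
      (lift (segments xs) (segments ys) (exit T2 (segment t) q'))"
    unfolding steps_append by blast
  have q': "q' \<in> states T2" using tr by (cases t) (auto dest: traversal_states)
  have out': "out3 (\<tau>s @ [\<tau>]) = out2 (zs @ vs)" using out out_word_T3[OF tr] \<tau> by simp
  show ?case
  proof (cases "q' \<in> fwd_states T2")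
    case True
    have "steps T1 (entry T1 w p0) (xs @ [t]) c2" using xs t by (rule steps_snocI)
    moreover have "steps T2 (entry T2 (segments (xs @ [t]) @ segments ys) (initial T2)) (zs @ vs)
        (segments (xs @ [t]), q', segments ys)"
      using vs True by (simp add: exit_def)
    moreover have "C = pair c2 q'" using C True by simp
    ultimately show ?thesis using ys out' q' by blast
  next
    case False
    have "steps T1 c1 (t # ys) d" using t ys by (rule steps_ConsI)
    moreover have "steps T2 (entry T2 (segments xs @ segments (t # ys)) (initial T2)) (zs @ vs)
        (segments xs, q', segments (t # ys))"
      using vs False by (simp add: exit_def)
    moreover have "C = pair c1 q'" using C False by simp
    ultimately show ?thesis using xs out' q' by blast
  qed
qed

text \<open>The run of \<open>zs\<close> is cut into traversals of single segments. A traversal with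
  at least one step shortens \<open>zs\<close>; one without steps crosses an empty segment in an
  unchanged direction and so reduces the number of segments ahead of \<open>T2\<close>. Hence the
  lexicographic measure.\<close>

lemma steps_T3_complete:
  assumes "steps T1 d ts c" "steps T1 c us (exit T1 w p)" "q \<in> states T2"
    and "steps T2 (segments ts, q, segments us) zs (exit T2 (segments ts @ segments us) f)"
    and "f \<in> fwd_states T2"
  shows "\<exists>\<tau>s. steps T3 (pair c q) \<tau>s (pair (exit T1 w p) f) \<and> out3 \<tau>s = out2 zs"
  using assms
proof (induction "(length zs, if q \<in> fwd_states T2 then length us else length ts)"
    arbitrary: c ts us q zs
    rule: wf_induct_rule[OF wf_lex_prod[OF wf_less_than wf_less_than]])
  case (1 ts us q zs c)
  note prems = "1.prems"
  \<comment> \<open>Either no segment lies ahead of \<open>T2\<close>, which then has already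
    halted, or the next one belongs to a transition \<open>t\<close>, to be done or undone.\<close>
  have "(q \<in> fwd_states T2 \<and> us = [] \<and> zs = [] \<and> q = f) \<or>
    (\<exists>xs ys c1 t c2. c = (if q \<in> fwd_states T2 then c1 else c2) \<and>
      steps T1 d xs c1 \<and> step T1 c1 t c2 \<and> steps T1 c2 ys (exit T1 w p) \<and>
      (if q \<in> fwd_states T2 then ts = xs \<and> us = t # ys else ts = xs @ [t] \<and> us = ys) \<and>
      (segments ts, q, segments us)
        = lift (segments xs) (segments ys) (entry T2 (segment t) q) \<and>
      segments ts @ segments us = segments xs @ segment t @ segments ys)"
    (is "?stuck \<or> (\<exists>xs ys c1 t c2. ?cross xs ys c1 t c2)")
  proof (cases "q \<in> fwd_states T2")
    case True
    show ?thesis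
    proof (cases us)
      case Nil
      then have "(segments ts, q, segments us) = exit T2 (segments ts) q"
        using True by (simp add: exit_def)
      then show ?thesis using prems(4) Nil True by (simp add: steps_from_exit exit_eq_iff)
    next
      case (Cons t ys)
      with prems(2) obtain c2 where "step T1 c t c2" "steps T1 c2 ys (exit T1 w p)" by auto
      then have "?cross ts ys c t c2" using Cons True prems(1) by (simp add: entry_def)
      then show ?thesis by blast
    qed
  next
    case False
    show ?thesis
    proof (cases ts rule: rev_cases)
      case Nil
      then have "(segments ts, q, segments us) = exit T2 (segments us) q"
        using False by (simp add: exit_def)
      \<comment> \<open>Halting at the left border would give \<open>q = f\<close>, but
        \<open>f\<close> is forward.\<close>
      then show ?thesis using prems(4,5) Nil False by (simp add: steps_from_exit exit_eq_iff)
    next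
      case (snoc xs t)
      with prems(1) obtain c1 where "steps T1 d xs c1" "step T1 c1 t c" by (auto simp: steps_append)
      then have "?cross xs us c1 t c" using snoc False prems(2) by (simp add: entry_def)
      then show ?thesis by blast
    qed
  qed
  then show ?case
  proof (elim disjE exE)
    assume ?stuck
    then have "pair c q = pair (exit T1 w p) f" "zs = []" using prems(2) by auto
    then show ?thesis by (intro exI[of _ "[]"]) simp
  next
    fix xs ys c1 t c2
    assume *: "?cross xs ys c1 t c2"
    then have c: "c = (if q \<in> fwd_states T2 then c1 else c2)" and xs: "steps T1 d xs c1"
      and t: "step T1 c1 t c2" and ys: "steps T1 c2 ys (exit T1 w p)"
      and eq: "if q \<in> fwd_states T2 then ts = xs \<and> us = t # ys else ts = xs @ [t] \<and> us = ys"
      by blast+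
    have "steps T2 (lift (segments xs) (segments ys) (entry T2 (segment t) q)) zs
        (exit T2 (segments xs @ tape (entry T2 (segment t) q) @ segments ys) f)"
      using prems(4) * by (metis tape_simps(3))
    then obtain vs zs' q' where zs: "zs = vs @ zs'"
      and vs: "steps T2 (entry T2 (segment t) q) vs (exit T2 (segment t) q')"
      and zs': "steps T2 (lift (segments xs) (segments ys) (exit T2 (segment t) q')) zs'
        (exit T2 (segments xs @ segment t @ segments ys) f)"
      by (rule steps_split_at_exit) (metis tape_simps(3))
    have tr: "traversal t q vs q'"
      using t prems(3) vs by (auto simp: traversal_def elim: stepE)
    have q': "q' \<in> states T2" using tr by (cases t) (auto dest: traversal_states)
    \<comment> \<open>A turn changes which list the second component of the measure counts, so the
      first one has to decrease.\<close>
    have turn: "vs \<noteq> []" if "(q \<in> fwd_states T2) \<noteq> (q' \<in> fwd_states T2)"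
      using that vs by (metis state_simps(3,4) steps.simps(1))
    let ?c = "if q' \<in> fwd_states T2 then c2 else c1"
    have "\<exists>\<tau>s. steps T3 (pair ?c q') \<tau>s (pair (exit T1 w p) f) \<and> out3 \<tau>s = out2 zs'"
    proof (cases "q' \<in> fwd_states T2")
      case True
      have "steps T1 d (xs @ [t]) c2" using xs t by (rule steps_snocI)
      moreover have "steps T2 (segments (xs @ [t]), q', segments ys) zs'
          (exit T2 (segments (xs @ [t]) @ segments ys) f)"
        using zs' True by (simp add: exit_def)
      moreover have "((length zs', if q' \<in> fwd_states T2 then length ys else length (xs @ [t])),
          (length zs, if q \<in> fwd_states T2 then length us else length ts))
            \<in> less_than <*lex*> less_than"
        using True eq zs turn by (cases vs) (auto split: if_splits)
      ultimately show ?thesis using "1.hyps"[OF _ _ ys q' _ prems(5)] True by (simp del: steps.simps)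
    next
      case False
      have "steps T1 c1 (t # ys) (exit T1 w p)" using t ys by (rule steps_ConsI)
      moreover have "steps T2 (segments xs, q', segments (t # ys)) zs'
          (exit T2 (segments xs @ segments (t # ys)) f)"
        using zs' False by (simp add: exit_def)
      moreover have "((length zs', if q' \<in> fwd_states T2 then length (t # ys) else length xs),
          (length zs, if q \<in> fwd_states T2 then length us else length ts))
            \<in> less_than <*lex*> less_than"
        using False eq zs turn by (cases vs) (auto split: if_splits)
      ultimately show ?thesis using "1.hyps"[OF _ xs _ q' _ prems(5)] False by (simp del: steps.simps)
    qed
    then obtain \<tau>s where "steps T3 (pair ?c q') \<tau>s (pair (exit T1 w p) f)" "out3 \<tau>s = out2 zs'"
      by blast
    then have "steps T3 (pair c q) (product_transition t q q' # \<tau>s) (pair (exit T1 w p) f)"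
      "out3 (product_transition t q q' # \<tau>s) = out2 zs"
      using step_T3_I[OF t tr] c zs out_word_T3[OF tr] by (auto intro: steps_ConsI simp del: steps.simps)
    then show ?thesis by blast
  qed
qed

lemma entry_T3: "entry T3 w (initial T3) = pair (entry T1 w (initial T1)) (initial T2)"
  and exit_T3: "exit T3 w (final T3) = pair (exit T1 w (final T1)) (final T2)"
  using ends by (auto simp: entry_def exit_def fwd_T3 states_def)

lemma transduction_T3: "transduction T3 = transduction T1 O transduction T2"
proof -
  have fa3: "is_two_fa T3" using is_two_ft_T3 by (simp add: is_two_ft_def)
  have "(u, w) \<in> transduction T1 O transduction T2" if "(u, w) \<in> transduction T3" for u w
  proof -
    let ?u = "mark_word u"
    from that obtain \<tau>s where u: "u \<in> lists (alphabet T1)"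
      and \<tau>s: "steps T3 (pair (entry T1 ?u (initial T1)) (initial T2)) \<tau>s
        (pair (exit T1 ?u (final T1)) (final T2))"
      and w: "w = out3 \<tau>s"
      unfolding transduction_iff[OF fa3] entry_T3 exit_T3 by auto
    from steps_T3_sound[OF \<tau>s] obtain ts us e zs
      where ts: "steps T1 (entry T1 ?u (initial T1)) ts (exit T1 ?u (final T1))"
      and us: "steps T1 (exit T1 ?u (final T1)) us e"
      and zs: "steps T2 (entry T2 (segments ts @ segments us) (initial T2)) zs
        (segments ts, final T2, segments us)"
      and out: "out3 \<tau>s = out2 zs"
      unfolding pair_inject by blast
    \<comment> \<open>\<open>T1\<close> has halted, so nothing is recorded beyond its position and
      the tape of \<open>T2\<close> is the complete marked output.\<close>
    have "us = []" using us by (simp add: steps_from_exit)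
    with zs have "steps T2 (entry T2 (mark_word (out1 ts)) (initial T2)) zs
        (exit T2 (mark_word (out1 ts)) (final T2))"
      using segments_accepting[OF ts] ends by (simp add: exit_def)
    moreover have "out1 ts \<in> lists (alphabet T2)"
      using steps_transitions[OF ts] ft1 alphabets unfolding is_two_ft_def by fastforce
    ultimately have "(out1 ts, w) \<in> transduction T2"
      using w out unfolding transduction_iff[OF fa2] by blast
    moreover have "(u, out1 ts) \<in> transduction T1"
      using u ts unfolding transduction_iff[OF fa1] by blast
    ultimately show ?thesis by blast
  qed
  moreover have "(u, w) \<in> transduction T3"
    if "(u, v) \<in> transduction T1" "(v, w) \<in> transduction T2" for u v w
  proof -
    let ?u = "mark_word u"
    from that(1) obtain ts where u: "u \<in> lists (alphabet T1)"
      and ts: "steps T1 (entry T1 ?u (initial T1)) ts (exit T1 ?u (final T1))" and v: "v = out1 ts"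
      unfolding transduction_iff[OF fa1] by blast
    from that(2) obtain zs where zs: "steps T2 (entry T2 (segments ts) (initial T2)) zs
        (exit T2 (segments ts) (final T2))" and w: "w = out2 zs"
      unfolding transduction_iff[OF fa2] v segments_accepting[OF ts] by blast
    have "\<exists>\<tau>s. steps T3 (pair (entry T1 ?u (initial T1)) (initial T2)) \<tau>s
        (pair (exit T1 ?u (final T1)) (final T2)) \<and> out3 \<tau>s = out2 zs"
      \<comment> \<open>At the start nothing lies to the left of \<open>T2\<close> and the whole run
        of \<open>T1\<close> lies ahead.\<close>
      using zs ends by (intro steps_T3_complete[OF _ ts, of _ "[]"]) (auto simp: entry_def states_def)
    then show ?thesis using u w unfolding transduction_iff[OF fa3] entry_T3 exit_T3 by auto
  qed
  ultimately show ?thesis by auto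
qed

end

theorem theorem1:
  fixes T1 :: "('a, 'q1, 'b) two_ft"
    and T2 :: "('b, 'q2, 'c) two_ft"
    and n1 n2 :: nat
  assumes "is_two_ft T1" and "reversible T1" and "card (states T1) = n1"
    and "is_two_ft T2" and "reversible T2" and "card (states T2) = n2"
    and "out_alphabet T1 = alphabet T2"
  shows "\<exists>T3 :: ('a, 'q1 \<times> 'q2, 'c) two_ft.
    is_two_ft T3 \<and> reversible T3 \<and>
    alphabet T3 = alphabet T1 \<and> out_alphabet T3 = out_alphabet T2 \<and>
    card (states T3) = n1 * n2 \<and>
    transduction T3 = transduction T1 O transduction T2"
proof -
  \<comment> \<open>Trimming supplies the two endmarker assumptions of the locale and preserves the
    states, alphabets and transduction of \<open>T1\<close>.\<close>
  interpret composition "trim T1" T2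
    using assms by unfold_locales (simp_all add: is_two_ft_trim reversible_trim transitions_trim)
  show ?thesis
    using assms is_two_ft_T3 reversible_T3 transduction_T3 transduction_trim[OF assms(1)]
    by (intro exI[of _ T3]) (simp add: card_cartesian_product)
qed

end
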